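(* Let $G$ be a finite group of order $L$, let $\Psi$ be a list of frequencies, and let $\lambda_\rho\ge0$ for $\rho\in\Psi$. If $$\sum_{\rho\in\Psi}\lambda_\rho^2\beta_\rho d_\rho^2>4\log L,$$ then there is a (computationally inefficient) algorithm that can distinguish between the spiked model $\mathrm{GSynch}_n(\{\lambda_\rho\},G,\Psi)$ and the unspiked model $\mathrm{GSynch}_n(0,G,\Psi)$; that is, there is a sequence of tests, taking the observation $\{Y_\rho\}_{\rho\in\Psi}$ as input, whose type I and type II error probabilities both tend to $0$ as $n\to\infty$.
   Context: Representations. Every irreducible complex representation $\rho$ of a finite group $G$ may be taken unitary and has real, complex, or quaternionic type. Real-type representations are taken to be defined by unitary matrices over $\mathbb{R}$, complex-type over $\mathbb{C}$, and quaternionic-type over the quaternions $\mathbb{H}$ (via the standard embedding of $\mathbb{H}$ into $2\times2$ complex matrices). $d_\rho$ is the dimension of $\rho$ over $\mathbb{R},\mathbb{C},\mathbb{H}$ respectively (so for quaternionic type $d_\rho$ is half the complex dimension), and $\beta_\rho=1,2,4$ respectively. A list of frequencies $\Psi$ is a finite set of pairwise non-isomorphic irreducible (over $\mathbb{C}$) representations of $G$, not containing the trivial representation, and not containing both $\rho$ and its conjugate $\bar\rho$ for any complex-type $\rho$. Noise. A standard Gaussian of real, complex, quaternionic type is $\mathcal{N}(0,1)$; $\mathcal{N}(0,\frac12)+\mathcal{N}(0,\frac12)i$; $\mathcal{N}(0,\frac14)+\mathcal{N}(0,\frac14)i+\mathcal{N}(0,\frac14)j+\mathcal{N}(0,\frac14)k$,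 respectively, with independent components. A GOE, GUE, GSE matrix is a random Hermitian matrix over $\mathbb{R},\mathbb{C},\mathbb{H}$ respectively, with off-diagonal entries standard Gaussians of the corresponding type and diagonal entries real $\mathcal{N}(0,2/\beta)$, $\beta=1,2,4$ respectively, independent except for the Hermitian constraint. Model. $\mathrm{GSynch}_n(\{\lambda_\rho\},G,\Psi)$, with $\lambda_\rho\ge0$ for $\rho\in\Psi$: draw $g\in G^n$ with independent uniformly distributed coordinates. Let $X_\rho$ be the $nd_\rho\times d_\rho$ matrix obtained by stacking the matrices $\rho(g_u)$, $u=1,\dots,n$. For each $\rho\in\Psi$ reveal the $nd_\rho\times nd_\rho$ matrix $Y_\rho=\frac{\lambda_\rho}nX_\rho X_\rho^*+\frac1{\sqrt{nd_\rho}}W_\rho$, where $W_\rho$ is a GOE, GUE or GSE matrix according to the type of $\rho$; the $W_\rho$ are independent across $\rho$ and independent of $g$. The model is the joint law of $\{Y_\rho\}_{\rho\in\Psi}$. Writing $0$ in place of $\{\lambda_\rho\}$ means $\lambda_\rho=0$ for all $\rho$. *)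

theory Defs
  imports "HOL-Probability.Probability" "HOL-Algebra.Group" "HOL-Algebra.Coset"
    "Jordan_Normal_Form.VS_Connect"
begin

section \<open>Quaternions\<close>

text \<open>\<open>Quat a b c d\<close> stands for \<open>a + b i + c j + d k\<close>.\<close>

datatype quat = Quat (qre: real) (qi: real) (qj: real) (qk: real)

instantiation quat :: real_algebra_1
begin

definition "0 = Quat 0 0 0 0"
definition "1 = Quat 1 0 0 0"
definition "p + q = Quat (qre p + qre q) (qi p + qi q) (qj p + qj q) (qk p + qk q)"
definition "- p = Quat (- qre p) (- qi p) (- qj p) (- qk p)"
definition "p - q = Quat (qre p - qre q) (qi p - qi q) (qj p - qj q) (qk p - qk q)"
definition "p * q = Quat
  (qre p * qre q - qi p * qi q - qj p * qj q - qk p * qk q)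
  (qre p * qi q + qi p * qre q + qj p * qk q - qk p * qj q)
  (qre p * qj q - qi p * qk q + qj p * qre q + qk p * qi q)
  (qre p * qk q + qi p * qj q - qj p * qi q + qk p * qre q)"
definition "scaleR r p = Quat (r * qre p) (r * qi p) (r * qj p) (r * qk p)"

instance
  by standard
    (simp_all add: zero_quat_def one_quat_def plus_quat_def uminus_quat_def minus_quat_def
      times_quat_def scaleR_quat_def quat.expand algebra_simps)

end

definition qcnj :: "quat \<Rightarrow> quat" where
  "qcnj q = Quat (qre q) (- qi q) (- qj q) (- qk q)"

definition quat_coords :: "quat \<Rightarrow> real \<times> real \<times> real \<times> real" where
  "quat_coords q = (qre q, qi q, qj q, qk q)"

definition quat_borel :: "quat measure" where
  "quat_borel = vimage_algebra UNIV quat_coords borel"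

definition qadj :: "quat mat \<Rightarrow> quat mat" where
  "qadj A = Matrix.mat (dim_col A) (dim_row A) (\<lambda>(i, j). qcnj (A $$ (j, i)))"

text \<open>The Borel sets of the space of \<open>m \<times> m\<close> quaternionic matrices.\<close>

definition qmat_borel :: "nat \<Rightarrow> quat mat measure" where
  "qmat_borel m = vimage_algebra (carrier_mat m m)
     (\<lambda>A. \<lambda>ij\<in>{..<m} \<times> {..<m}. A $$ ij) (\<Pi>\<^sub>M ij\<in>{..<m} \<times> {..<m}. quat_borel)"

section \<open>Complex representations of a group\<close>

definition complex_rep :: "('a, 'b) monoid_scheme \<Rightarrow> nat \<Rightarrow> ('a \<Rightarrow> complex mat) \<Rightarrow> bool" where
  "complex_rep G m R \<longleftrightarrow>
     (\<forall>g\<in>carrier G. R g \<in> carrier_mat m m \<and> invertible_mat (R g)) \<and>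
     (\<forall>g\<in>carrier G. \<forall>h\<in>carrier G. R (g \<otimes>\<^bsub>G\<^esub> h) = R g * R h)"

definition rep_iso :: "('a, 'b) monoid_scheme \<Rightarrow>
    nat \<Rightarrow> ('a \<Rightarrow> complex mat) \<Rightarrow> nat \<Rightarrow> ('a \<Rightarrow> complex mat) \<Rightarrow> bool" where
  "rep_iso G m R m' R' \<longleftrightarrow> m = m' \<and>
     (\<exists>P\<in>carrier_mat m m. invertible_mat P \<and> (\<forall>g\<in>carrier G. P * R g = R' g * P))"

definition irreducible_rep :: "('a, 'b) monoid_scheme \<Rightarrow> nat \<Rightarrow> ('a \<Rightarrow> complex mat) \<Rightarrow> bool" where
  "irreducible_rep G m R \<longleftrightarrow> complex_rep G m R \<and> 0 < m \<and>
     (\<forall>V. VectorSpace.subspace class_ring V (module_vec TYPE(complex) m) \<and>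
          (\<forall>g\<in>carrier G. \<forall>v\<in>V. R g *\<^sub>v v \<in> V) \<longrightarrow>
          V = {0\<^sub>v m} \<or> V = carrier_vec m)"

definition conj_rep :: "('a \<Rightarrow> complex mat) \<Rightarrow> 'a \<Rightarrow> complex mat" where
  "conj_rep R g = map_mat cnj (R g)"

definition trivial_rep :: "'a \<Rightarrow> complex mat" where
  "trivial_rep g = 1\<^sub>m 1"

datatype rep_type = RealType | ComplexType | QuatType

definition realizable_over_reals ::
    "('a, 'b) monoid_scheme \<Rightarrow> nat \<Rightarrow> ('a \<Rightarrow> complex mat) \<Rightarrow> bool" where
  "realizable_over_reals G m R \<longleftrightarrow>
     (\<exists>R'. complex_rep G m R' \<and> rep_iso G m R m R' \<and>
        (\<forall>g\<in>carrier G. \<forall>i<m. \<forall>j<m. R' g $$ (i, j) \<in> \<real>))"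

text \<open>
  The real / complex / quaternionic trichotomy of irreducible representations. A representation
  isomorphic to its conjugate (that is, with real character) is of quaternionic type when it is
  not realizable over the reals.
\<close>

fun has_rep_type :: "('a, 'b) monoid_scheme \<Rightarrow> nat \<Rightarrow> ('a \<Rightarrow> complex mat) \<Rightarrow> rep_type \<Rightarrow> bool" where
  "has_rep_type G m R RealType \<longleftrightarrow> realizable_over_reals G m R"
| "has_rep_type G m R ComplexType \<longleftrightarrow> \<not> rep_iso G m R m (conj_rep R)"
| "has_rep_type G m R QuatType \<longleftrightarrow>
     rep_iso G m R m (conj_rep R) \<and> \<not> realizable_over_reals G m R"

section \<open>Frequencies\<close>

text \<open>
  A frequency of type \<open>\<real>\<close>, \<open>\<complex>\<close> or \<open>\<bbbH>\<close> is given by unitary matrices over the corresponding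
  division algebra. All three are subalgebras of the quaternions, so the matrices of every
  frequency are stored as quaternionic ones, with entries confined to \<open>scalars t\<close>.
\<close>

datatype 'a freq = Freq (ftype: rep_type) (fdim: nat) (frep: "'a \<Rightarrow> quat mat")

fun beta :: "rep_type \<Rightarrow> nat" where
  "beta RealType = 1"
| "beta ComplexType = 2"
| "beta QuatType = 4"

fun scalars :: "rep_type \<Rightarrow> quat set" where
  "scalars RealType = {Quat a 0 0 0 | a. True}"
| "scalars ComplexType = {Quat a b 0 0 | a b. True}"
| "scalars QuatType = UNIV"

text \<open>
  The standard embedding of the quaternions: for complex \<open>z, w\<close>, the quaternion \<open>z + w j\<close>
  becomes the matrix with rows \<open>(z, w)\<close> and \<open>(- cnj w, cnj z)\<close>.
\<close>

definition quat_entry :: "quat \<Rightarrow> nat \<Rightarrow> nat \<Rightarrow> complex" where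
  "quat_entry q r s =
     (let z = Complex (qre q) (qi q); w = Complex (qj q) (qk q) in
      if r = 0 then (if s = 0 then z else w) else (if s = 0 then - cnj w else cnj z))"

fun complex_mat_of :: "rep_type \<Rightarrow> quat mat \<Rightarrow> complex mat" where
  "complex_mat_of QuatType A = Matrix.mat (2 * dim_row A) (2 * dim_col A)
     (\<lambda>(i, j). quat_entry (A $$ (i div 2, j div 2)) (i mod 2) (j mod 2))"
| "complex_mat_of _ A = map_mat (\<lambda>q. Complex (qre q) (qi q)) A"

definition cdim :: "'a freq \<Rightarrow> nat" where
  "cdim \<rho> = (if ftype \<rho> = QuatType then 2 * fdim \<rho> else fdim \<rho>)"

definition crep :: "'a freq \<Rightarrow> 'a \<Rightarrow> complex mat" where
  "crep \<rho> g = complex_mat_of (ftype \<rho>) (frep \<rho> g)"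

definition unitary_rep :: "('a, 'b) monoid_scheme \<Rightarrow> 'a freq \<Rightarrow> bool" where
  "unitary_rep G \<rho> \<longleftrightarrow>
     (\<forall>g\<in>carrier G. frep \<rho> g \<in> carrier_mat (fdim \<rho>) (fdim \<rho>) \<and>
        elements_mat (frep \<rho> g) \<subseteq> scalars (ftype \<rho>) \<and>
        frep \<rho> g * qadj (frep \<rho> g) = 1\<^sub>m (fdim \<rho>) \<and>
        qadj (frep \<rho> g) * frep \<rho> g = 1\<^sub>m (fdim \<rho>)) \<and>
     (\<forall>g\<in>carrier G. \<forall>h\<in>carrier G. frep \<rho> (g \<otimes>\<^bsub>G\<^esub> h) = frep \<rho> g * frep \<rho> h)"

definition frequency :: "('a, 'b) monoid_scheme \<Rightarrow> 'a freq \<Rightarrow> bool" where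
  "frequency G \<rho> \<longleftrightarrow> unitary_rep G \<rho> \<and> irreducible_rep G (cdim \<rho>) (crep \<rho>) \<and>
     has_rep_type G (cdim \<rho>) (crep \<rho>) (ftype \<rho>)"

text \<open>
  The last clause excludes that a complex-type \<open>\<rho>\<close> and its conjugate are both present,
  up to isomorphism.
\<close>

definition frequency_list :: "('a, 'b) monoid_scheme \<Rightarrow> 'a freq set \<Rightarrow> bool" where
  "frequency_list G \<Psi> \<longleftrightarrow> finite \<Psi> \<and>
     (\<forall>\<rho>\<in>\<Psi>. frequency G \<rho>) \<and>
     (\<forall>\<rho>\<in>\<Psi>. \<forall>\<sigma>\<in>\<Psi>. \<rho> \<noteq> \<sigma> \<longrightarrow> \<not> rep_iso G (cdim \<rho>) (crep \<rho>) (cdim \<sigma>) (crep \<sigma>)) \<and>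
     (\<forall>\<rho>\<in>\<Psi>. \<not> rep_iso G (cdim \<rho>) (crep \<rho>) 1 trivial_rep) \<and>
     (\<forall>\<rho>\<in>\<Psi>. \<forall>\<sigma>\<in>\<Psi>. ftype \<rho> = ComplexType \<longrightarrow>
        \<not> rep_iso G (cdim \<sigma>) (crep \<sigma>) (cdim \<rho>) (conj_rep (crep \<rho>)))"

section \<open>Gaussian noise\<close>

text \<open>The parameter is the variance, whereas \<open>normal_density\<close> takes a standard deviation.\<close>

definition centred_normal :: "real \<Rightarrow> real measure" where
  "centred_normal v = density lborel (normal_density 0 (sqrt v))"

fun std_gaussian :: "rep_type \<Rightarrow> quat measure" where
  "std_gaussian RealType = distr (centred_normal 1) quat_borel (\<lambda>a. Quat a 0 0 0)"
| "std_gaussian ComplexType =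
     distr (centred_normal (1 / 2) \<Otimes>\<^sub>M centred_normal (1 / 2)) quat_borel
       (\<lambda>(a, b). Quat a b 0 0)"
| "std_gaussian QuatType =
     distr (centred_normal (1 / 4) \<Otimes>\<^sub>M centred_normal (1 / 4) \<Otimes>\<^sub>M
            centred_normal (1 / 4) \<Otimes>\<^sub>M centred_normal (1 / 4)) quat_borel
       (\<lambda>(a, b, c, d). Quat a b c d)"

definition diag_gaussian :: "rep_type \<Rightarrow> quat measure" where
  "diag_gaussian t = distr (centred_normal (2 / beta t)) quat_borel of_real"

text \<open>
  GOE, GUE or GSE of size \<open>m\<close>, according to the type: the entries on and above the diagonal
  are drawn independently, and the others are determined by the Hermitian constraint.
\<close>

definition hermitian_of :: "nat \<Rightarrow> (nat \<times> nat \<Rightarrow> quat) \<Rightarrow> quat mat" where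
  "hermitian_of m w =
     Matrix.mat m m (\<lambda>(i, j). if i \<le> j then w (i, j) else qcnj (w (j, i)))"

definition gaussian_ensemble :: "rep_type \<Rightarrow> nat \<Rightarrow> quat mat measure" where
  "gaussian_ensemble t m =
     distr (\<Pi>\<^sub>M (i, j)\<in>{(i, j). i \<le> j \<and> j < m}. if i = j then diag_gaussian t else std_gaussian t)
       (qmat_borel m) (hermitian_of m)"

section \<open>The synchronization model\<close>

text \<open>
  Row \<open>u d + a\<close> (for \<open>u < n\<close>, \<open>a < d\<close>) of the stacked matrix is row \<open>a\<close> of \<open>\<rho> (g u)\<close>;
  the group elements \<open>g 0, \<dots>, g (n - 1)\<close> are indexed from 0.
\<close>

definition stacked :: "nat \<Rightarrow> 'a freq \<Rightarrow> (nat \<Rightarrow> 'a) \<Rightarrow> quat mat" where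
  "stacked n \<rho> g = Matrix.mat (n * fdim \<rho>) (fdim \<rho>)
     (\<lambda>(i, b). frep \<rho> (g (i div fdim \<rho>)) $$ (i mod fdim \<rho>, b))"

definition spiked :: "nat \<Rightarrow> real \<Rightarrow> 'a freq \<Rightarrow> (nat \<Rightarrow> 'a) \<Rightarrow> quat mat \<Rightarrow> quat mat" where
  "spiked n l \<rho> g W =
     of_real (l / n) \<cdot>\<^sub>m (stacked n \<rho> g * qadj (stacked n \<rho> g))
     + of_real (1 / sqrt (n * fdim \<rho>)) \<cdot>\<^sub>m W"

definition obs_space :: "nat \<Rightarrow> 'a freq set \<Rightarrow> ('a freq \<Rightarrow> quat mat) measure" where
  "obs_space n \<Psi> = (\<Pi>\<^sub>M \<rho>\<in>\<Psi>. qmat_borel (n * fdim \<rho>))"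

definition gsynch :: "nat \<Rightarrow> ('a freq \<Rightarrow> real) \<Rightarrow> ('a, 'b) monoid_scheme \<Rightarrow> 'a freq set \<Rightarrow>
    ('a freq \<Rightarrow> quat mat) measure" where
  "gsynch n lam G \<Psi> =
     distr ((\<Pi>\<^sub>M u\<in>{..<n}. uniform_count_measure (carrier G)) \<Otimes>\<^sub>M
            (\<Pi>\<^sub>M \<rho>\<in>\<Psi>. gaussian_ensemble (ftype \<rho>) (n * fdim \<rho>)))
       (obs_space n \<Psi>)
       (\<lambda>(g, W). \<lambda>\<rho>\<in>\<Psi>. spiked n (lam \<rho>) \<rho> g (W \<rho>))"

section \<open>Well-definedness of the model\<close>

text \<open>
  \<open>distr\<close> is only meaningful along measurable maps. All maps used above are measurable, so the
  model is a probability measure.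
\<close>

lemma space_quat_borel [simp]: "space quat_borel = UNIV"
  by (simp add: quat_borel_def)

lemma measurable_quat_coords [measurable]: "quat_coords \<in> borel_measurable quat_borel"
  unfolding quat_borel_def by (rule measurable_vimage_algebra1) simp

lemma measurable_quat_comps [measurable]:
  "qre \<in> borel_measurable quat_borel" "qi \<in> borel_measurable quat_borel"
  "qj \<in> borel_measurable quat_borel" "qk \<in> borel_measurable quat_borel"
proof -
  have e: "qre = (\<lambda>q. fst (quat_coords q))" "qi = (\<lambda>q. fst (snd (quat_coords q)))"
    "qj = (\<lambda>q. fst (snd (snd (quat_coords q))))" "qk = (\<lambda>q. snd (snd (snd (quat_coords q))))"
    by (auto simp: quat_coords_def)
  have b: "quat_coords \<in> measurable quat_borel (borel \<Otimes>\<^sub>M borel \<Otimes>\<^sub>M borel \<Otimes>\<^sub>M borel)"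
    using measurable_quat_coords by (simp add: borel_prod)
  note b[measurable]
  show "qre \<in> borel_measurable quat_borel" "qi \<in> borel_measurable quat_borel"
    "qj \<in> borel_measurable quat_borel" "qk \<in> borel_measurable quat_borel"
    unfolding e by measurable
qed

lemma measurable_into_quat:
  assumes "(\<lambda>x. qre (f x)) \<in> borel_measurable M" "(\<lambda>x. qi (f x)) \<in> borel_measurable M"
    "(\<lambda>x. qj (f x)) \<in> borel_measurable M" "(\<lambda>x. qk (f x)) \<in> borel_measurable M"
  shows "f \<in> measurable M quat_borel"
  unfolding quat_borel_def
  by (rule measurable_vimage_algebra2) (use assms in \<open>simp_all add: quat_coords_def\<close>)

lemma measurable_quat_ops [measurable (raw)]:
  assumes [measurable]: "f \<in> measurable M quat_borel" "g \<in> measurable M quat_borel"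
  shows "(\<lambda>x. f x + g x) \<in> measurable M quat_borel"
    "(\<lambda>x. f x * g x) \<in> measurable M quat_borel"
    "(\<lambda>x. qcnj (f x)) \<in> measurable M quat_borel"
  by (rule measurable_into_quat, simp_all add: plus_quat_def times_quat_def qcnj_def)+

lemma of_real_quat: "of_real r = Quat r 0 0 0"
  by (simp add: of_real_def scaleR_quat_def one_quat_def)

lemma space_qmat_borel [simp]: "space (qmat_borel m) = carrier_mat m m"
  by (simp add: qmat_borel_def)

lemma measurable_into_qmat:
  assumes "\<And>x. x \<in> space M \<Longrightarrow> f x \<in> carrier_mat m m"
    and "\<And>i j. i < m \<Longrightarrow> j < m \<Longrightarrow> (\<lambda>x. f x $$ (i, j)) \<in> measurable M quat_borel"
  shows "f \<in> measurable M (qmat_borel m)"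
  unfolding qmat_borel_def
  by (rule measurable_vimage_algebra2) (use assms in \<open>auto intro!: measurable_restrict\<close>)

lemma measurable_qmat_entry:
  assumes "i < m" "j < m"
  shows "(\<lambda>A. A $$ (i, j)) \<in> measurable (qmat_borel m) quat_borel"
proof -
  have 1: "(\<lambda>A. \<lambda>ij\<in>{..<m} \<times> {..<m}. A $$ ij) \<in> measurable (qmat_borel m) (\<Pi>\<^sub>M ij\<in>{..<m} \<times> {..<m}. quat_borel)"
    unfolding qmat_borel_def by (rule measurable_vimage_algebra1) (auto simp: space_PiM)
  have 2: "(\<lambda>w. w (i,j)) \<in> measurable (\<Pi>\<^sub>M ij\<in>{..<m} \<times> {..<m}. quat_borel) quat_borel"
    by (rule measurable_component_singleton) (use assms in auto)
  show ?thesis using measurable_compose[OF 1 2] assms by simp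
qed

lemma prob_space_centred_normal: "0 < v \<Longrightarrow> prob_space (centred_normal v)"
  unfolding centred_normal_def by (rule prob_space_normal_density) simp

lemma sets_centred_normal [measurable_cong, simp]: "sets (centred_normal v) = sets borel"
  by (simp add: centred_normal_def)

lemma prob_space_std_gaussian: "prob_space (std_gaussian t)"
proof (cases t)
  case RealType
  show ?thesis unfolding RealType std_gaussian.simps
    by (intro prob_space.prob_space_distr prob_space_centred_normal measurable_into_quat) auto
next
  case ComplexType
  have "prob_space (centred_normal (1/2) \<Otimes>\<^sub>M centred_normal (1/2))"
    by (intro prob_space_pair prob_space_centred_normal) auto
  then show ?thesis unfolding ComplexType std_gaussian.simps
    by (rule prob_space.prob_space_distr) (auto intro!: measurable_into_quat simp: case_prod_beta)
next
  case QuatType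
  have "prob_space (centred_normal (1 / 4) \<Otimes>\<^sub>M centred_normal (1 / 4) \<Otimes>\<^sub>M
            centred_normal (1 / 4) \<Otimes>\<^sub>M centred_normal (1 / 4))"
    by (intro prob_space_pair prob_space_centred_normal) auto
  then show ?thesis unfolding QuatType std_gaussian.simps
    by (rule prob_space.prob_space_distr) (auto intro!: measurable_into_quat simp: case_prod_beta)
qed

lemma sets_std_gaussian [measurable_cong, simp]: "sets (std_gaussian t) = sets quat_borel"
  by (cases t) auto

lemma sets_diag_gaussian [measurable_cong, simp]: "sets (diag_gaussian t) = sets quat_borel"
  by (simp add: diag_gaussian_def)

lemma prob_space_diag_gaussian: "prob_space (diag_gaussian t)"
  unfolding diag_gaussian_def
  by (intro prob_space.prob_space_distr prob_space_centred_normal measurable_into_quat)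
    (cases t; auto simp: of_real_quat)+

lemma prob_space_gaussian_ensemble: "prob_space (gaussian_ensemble t m)"
  unfolding gaussian_ensemble_def
proof (rule prob_space.prob_space_distr)
  let ?I = "{(i, j). i \<le> j \<and> j < m}"
  let ?M = "\<lambda>(i, j). if i = (j::nat) then diag_gaussian t else std_gaussian t"
  show "prob_space (PiM ?I ?M)"
    by (rule prob_space_PiM) (auto simp: prob_space_diag_gaussian prob_space_std_gaussian)
  have c: "(\<lambda>w. w p) \<in> measurable (PiM ?I ?M) quat_borel" if "p \<in> ?I" for p
  proof -
    have "(\<lambda>w. w p) \<in> measurable (PiM ?I ?M) (?M p)"
      using that by (rule measurable_component_singleton)
    moreover have "sets (?M p) = sets quat_borel" by (auto simp: case_prod_beta)
    ultimately show ?thesis by (simp cong: measurable_cong_sets)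
  qed
  show "hermitian_of m \<in> measurable (PiM ?I ?M) (qmat_borel m)"
  proof (rule measurable_into_qmat)
    fix i j assume *: "i < m" "j < m"
    show "(\<lambda>w. hermitian_of m w $$ (i, j)) \<in> measurable (PiM ?I ?M) quat_borel"
    proof (cases "i \<le> j")
      case True
      then show ?thesis using c[of "(i,j)"] * by (simp add: hermitian_of_def)
    next
      case False
      then show ?thesis using measurable_quat_ops(3)[OF c[of "(j,i)"] c[of "(j,i)"]] *
        by (simp add: hermitian_of_def)
    qed
  qed (simp add: hermitian_of_def)
qed

lemma sets_gaussian_ensemble [measurable_cong, simp]: "sets (gaussian_ensemble t m) = sets (qmat_borel m)"
  by (simp add: gaussian_ensemble_def)

lemma prob_space_gsynch:
  assumes fin: "finite (carrier G)" "carrier G \<noteq> {}"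
  shows "prob_space (gsynch n lam G \<Psi>)"
  unfolding gsynch_def
proof (rule prob_space.prob_space_distr)
  let ?P = "(\<Pi>\<^sub>M u\<in>{..<n}. uniform_count_measure (carrier G))"
  let ?Q = "(\<Pi>\<^sub>M \<rho>\<in>\<Psi>. gaussian_ensemble (ftype \<rho>) (n * fdim \<rho>))"
  show "prob_space (?P \<Otimes>\<^sub>M ?Q)"
    by (intro prob_space_pair prob_space_PiM prob_space_gaussian_ensemble prob_space_uniform_count_measure fin)
  have g: "(\<lambda>x. F (fst x u)) \<in> measurable (?P \<Otimes>\<^sub>M ?Q) quat_borel" if "u < n" for u and F :: "'a \<Rightarrow> quat"
  proof -
    have 1: "fst \<in> measurable (?P \<Otimes>\<^sub>M ?Q) ?P" by simp
    have 2: "(\<lambda>g. g u) \<in> measurable ?P (uniform_count_measure (carrier G))"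
      by (rule measurable_component_singleton) (use that in auto)
    have 3: "F \<in> measurable (uniform_count_measure (carrier G)) quat_borel"
      by (auto simp: measurable_def space_uniform_count_measure sets_uniform_count_measure)
    show ?thesis using measurable_compose[OF measurable_compose[OF 1 2] 3] by simp
  qed
  show "(\<lambda>(g, W). \<lambda>\<rho>\<in>\<Psi>. spiked n (lam \<rho>) \<rho> g (W \<rho>)) \<in> measurable (?P \<Otimes>\<^sub>M ?Q) (obs_space n \<Psi>)"
    unfolding obs_space_def case_prod_beta
  proof (rule measurable_restrict, rule measurable_into_qmat)
    fix \<rho> assume r: "\<rho> \<in> \<Psi>"
    let ?m = "n * fdim \<rho>"
    have W0: "(\<lambda>x. snd x \<rho>) \<in> measurable (?P \<Otimes>\<^sub>M ?Q) (qmat_borel ?m)"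
    proof -
      have 1: "snd \<in> measurable (?P \<Otimes>\<^sub>M ?Q) ?Q" by simp
      have 2: "(\<lambda>g. g \<rho>) \<in> measurable ?Q (gaussian_ensemble (ftype \<rho>) ?m)"
        using r by (rule measurable_component_singleton)
      have "(\<lambda>x. snd x \<rho>) \<in> measurable (?P \<Otimes>\<^sub>M ?Q) (gaussian_ensemble (ftype \<rho>) ?m)"
        using measurable_compose[OF 1 2] .
      then show ?thesis by (simp cong: measurable_cong_sets)
    qed
    have cm: "snd x \<rho> \<in> carrier_mat ?m ?m" if "x \<in> space (?P \<Otimes>\<^sub>M ?Q)" for x
      using measurable_space[OF W0 that] by simp
    show "spiked n (lam \<rho>) \<rho> (fst x) (snd x \<rho>) \<in> carrier_mat ?m ?m"
      if "x \<in> space (?P \<Otimes>\<^sub>M ?Q)" for x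
      using cm[OF that] by (auto simp: spiked_def)
    fix i j assume ij: "i < ?m" "j < ?m"
    have d: "fdim \<rho> > 0" using ij by (cases "fdim \<rho>") auto
    have u: "k div fdim \<rho> < n" if "k < ?m" for k using that by (simp add: less_mult_imp_div_less)
    have s: "(\<lambda>x. \<Sum>b<fdim \<rho>. stacked n \<rho> (fst x) $$ (i, b) * qcnj (stacked n \<rho> (fst x) $$ (j, b)))
        \<in> measurable (?P \<Otimes>\<^sub>M ?Q) quat_borel"
    proof -
      have "(\<lambda>x. \<Sum>b\<in>B. stacked n \<rho> (fst x) $$ (i, b) * qcnj (stacked n \<rho> (fst x) $$ (j, b)))
        \<in> measurable (?P \<Otimes>\<^sub>M ?Q) quat_borel" if "finite B" "B \<subseteq> {..<fdim \<rho>}" for B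
        using that
      proof (induction B)
        case empty then show ?case by simp
      next
        case (insert b B)
        have st: "(\<lambda>x. stacked n \<rho> (fst x) $$ (k, b)) \<in> measurable (?P \<Otimes>\<^sub>M ?Q) quat_borel" if "k < ?m" for k
          using g[OF u[OF that], of "\<lambda>h. frep \<rho> h $$ (k mod fdim \<rho>, b)"] that insert.prems
          by (simp add: stacked_def)
        have "(\<lambda>x. stacked n \<rho> (fst x) $$ (i, b) * qcnj (stacked n \<rho> (fst x) $$ (j, b)) +
          (\<Sum>b\<in>B. stacked n \<rho> (fst x) $$ (i, b) * qcnj (stacked n \<rho> (fst x) $$ (j, b))))
           \<in> measurable (?P \<Otimes>\<^sub>M ?Q) quat_borel"
          using insert.prems insert.IH
          by (intro measurable_quat_ops(1,2) measurable_quat_ops(3)[of _ _ "\<lambda>_. 0"] st ij) auto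
        then show ?case using insert.hyps by simp
      qed
      from this[of "{..<fdim \<rho>}"] show ?thesis by simp
    qed
    have e: "spiked n (lam \<rho>) \<rho> (fst x) (snd x \<rho>) $$ (i, j) =
      of_real (lam \<rho> / n) * (\<Sum>b<fdim \<rho>. stacked n \<rho> (fst x) $$ (i, b) * qcnj (stacked n \<rho> (fst x) $$ (j, b)))
      + of_real (1 / sqrt (n * fdim \<rho>)) * (snd x \<rho> $$ (i,j))" if "x \<in> space (?P \<Otimes>\<^sub>M ?Q)" for x
    proof -
      have [simp]: "dim_row (stacked n \<rho> (fst x)) = ?m" "dim_col (stacked n \<rho> (fst x)) = fdim \<rho>"
        by (auto simp: stacked_def)
      have p: "stacked n \<rho> (fst x) * qadj (stacked n \<rho> (fst x)) \<in> carrier_mat ?m ?m"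
        by (rule carrier_matI) (auto simp: qadj_def)
      have "(stacked n \<rho> (fst x) * qadj (stacked n \<rho> (fst x))) $$ (i,j) =
         (\<Sum>b<fdim \<rho>. stacked n \<rho> (fst x) $$ (i, b) * qcnj (stacked n \<rho> (fst x) $$ (j, b)))"
        using ij by (simp add: qadj_def scalar_prod_def atLeast0LessThan)
      then show ?thesis using ij cm[OF that] p unfolding spiked_def
        by auto
    qed
    have "(\<lambda>x. of_real (lam \<rho> / n) * (\<Sum>b<fdim \<rho>. stacked n \<rho> (fst x) $$ (i, b) * qcnj (stacked n \<rho> (fst x) $$ (j, b)))
      + of_real (1 / sqrt (n * fdim \<rho>)) * (snd x \<rho> $$ (i,j))) \<in> measurable (?P \<Otimes>\<^sub>M ?Q) quat_borel"
      by (intro measurable_quat_ops(1,2) s measurable_compose[OF W0 measurable_qmat_entry] ij) auto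
    then show "(\<lambda>x. spiked n (lam \<rho>) \<rho> (fst x) (snd x \<rho>) $$ (i, j)) \<in> measurable (?P \<Otimes>\<^sub>M ?Q) quat_borel"
      by (subst measurable_cong[OF e])
  qed
qed


end

theory Submission
  imports Defs
begin

text \<open>
  The test compares with a threshold the maximum, over all \<open>h \<in> G\<^sup>n\<close>, of the statistic
  \<open>T h = \<Sum>\<^sub>\<rho> \<lambda>\<^sub>\<rho> \<beta>\<^sub>\<rho> d\<^sub>\<rho> \<langle>Y\<^sub>\<rho>, X\<^sub>\<rho>(h) X\<^sub>\<rho>(h)\<^sup>*\<rangle>\<close> (real Frobenius inner product). By unitarity
  \<open>X\<^sub>\<rho>(h) X\<^sub>\<rho>(h)\<^sup>*\<close> has squared norm \<open>n\<^sup>2 d\<^sub>\<rho>\<close> for every \<open>h\<close>, so with \<open>S = \<Sum>\<^sub>\<rho> \<lambda>\<^sub>\<rho>\<^sup>2 \<beta>\<^sub>\<rho> d\<^sub>\<rho>\<^sup>2\<close> the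
  noise contributes to \<open>T h\<close> a centred Gaussian of variance at most \<open>2 n S\<close>, while at the true group
  elements the spike contributes exactly \<open>n S\<close>. Put the threshold at \<open>n t\<close> with
  \<open>2 sqrt (S ln L) < t < S\<close>. A union bound over the \<open>L\<^sup>n\<close> candidates gives type I error at most
  \<open>(L exp (- t\<^sup>2 / (4 S)))\<^sup>n\<close>, and looking only at the true group elements gives type II error at
  most \<open>exp (- (S - t)\<^sup>2 / (4 S))\<^sup>n\<close>.
\<close>

section \<open>Gram matrices of the stacked representations\<close>

text \<open>The Euclidean inner product of R^4, that is, the real part of \<open>p * qcnj q\<close>.
  Being real-valued, it serves all three types at once.\<close>

definition qinner :: "quat \<Rightarrow> quat \<Rightarrow> real" where
  "qinner p q = qre p * qre q + qi p * qi q + qj p * qj q + qk p * qk q"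

lemma qinner_self: "qinner q q = (qre q)\<^sup>2 + (qi q)\<^sup>2 + (qj q)\<^sup>2 + (qk q)\<^sup>2"
  by (simp add: qinner_def power2_eq_square)

lemma qinner_linear:
  "qinner (p + q) r = qinner p r + qinner q r"
  "qinner (of_real x * p) r = x * qinner p r"
  by (simp_all add: qinner_def plus_quat_def times_quat_def of_real_quat algebra_simps)

lemma qinner_qcnj: "qinner (qcnj p) (qcnj q) = qinner p q"
  by (simp add: qinner_def qcnj_def)

lemma qcnj_simps:
  "qcnj (p * q) = qcnj q * qcnj p" "qcnj (p + q) = qcnj p + qcnj q"
  "qcnj (qcnj p) = p" "qcnj 0 = 0"
  by (simp_all add: qcnj_def times_quat_def plus_quat_def zero_quat_def)

lemma qcnj_sum: "qcnj (sum f A) = (\<Sum>x\<in>A. qcnj (f x))"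
  by (induction A rule: infinite_finite_induct) (simp_all add: qcnj_simps)

lemma mult_qcnj_self: "q * qcnj q = of_real (qinner q q)"
  by (simp add: qcnj_def times_quat_def of_real_quat qinner_def)

lemma qadj_carrier [simp]: "A \<in> carrier_mat m k \<Longrightarrow> qadj A \<in> carrier_mat k m"
  by (auto simp: qadj_def)

lemma dim_qadj [simp]: "dim_row (qadj A) = dim_col A" "dim_col (qadj A) = dim_row A"
  by (simp_all add: qadj_def)

lemma qadj_qadj: "qadj (qadj A) = A"
  by (rule eq_matI) (auto simp: qadj_def qcnj_simps)

lemma qadj_mult:
  assumes "A \<in> carrier_mat m k" "B \<in> carrier_mat k l"
  shows "qadj (A * B) = qadj B * qadj A"
  by (rule eq_matI) (use assms in \<open>auto simp: qadj_def scalar_prod_def qcnj_sum qcnj_simps\<close>)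

text \<open>The real part of the trace of A times the adjoint of B. The index range is read off
  \<open>B\<close>, the fixed matrix in every use, so that as a function of \<open>A\<close> this is
  a sum over a constant range.\<close>

definition frob :: "quat mat \<Rightarrow> quat mat \<Rightarrow> real" where
  "frob A B = (\<Sum>p\<in>{..<dim_row B} \<times> {..<dim_col B}. qinner (A $$ p) (B $$ p))"

lemma frob_linear:
  assumes "A \<in> carrier_mat m m" "B \<in> carrier_mat m m" "C \<in> carrier_mat m m"
  shows "frob (of_real x \<cdot>\<^sub>m A + of_real y \<cdot>\<^sub>m B) C = x * frob A C + y * frob B C"
proof -
  have "qinner ((of_real x \<cdot>\<^sub>m A + of_real y \<cdot>\<^sub>m B) $$ p) (C $$ p) =
      x * qinner (A $$ p) (C $$ p) + y * qinner (B $$ p) (C $$ p)" if "p \<in> {..<m} \<times> {..<m}" for p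
    using that assms by (auto simp: qinner_linear)
  then show ?thesis using assms
    by (simp add: frob_def sum.distrib sum_distrib_left)
qed

text \<open>A diagonal entry of \<open>U * qadj U\<close> is the squared norm of a row of
  \<open>U\<close>, so each of the d rows contributes 1.\<close>

lemma frob_unitary:
  assumes "U \<in> carrier_mat d d" "U * qadj U = 1\<^sub>m d"
  shows "frob U U = d"
proof -
  have "(\<Sum>b<d. qinner (U $$ (a, b)) (U $$ (a, b))) = 1" if a: "a < d" for a
  proof -
    have "of_real (\<Sum>b<d. qinner (U $$ (a, b)) (U $$ (a, b))) = (U * qadj U) $$ (a, a)"
      using a assms(1) by (simp add: qadj_def scalar_prod_def mult_qcnj_self atLeast0LessThan)
    also have "\<dots> = of_real 1" using a by (simp add: assms(2))
    finally show ?thesis by (simp only: of_real_eq_iff)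
  qed
  then show ?thesis using assms(1) by (simp add: frob_def sum.cartesian_product')
qed

text \<open>Cuts the range into n consecutive blocks of length d, turning sums over matrix indices
  into sums over blocks and positions inside a block.\<close>

lemma sum_div_mod:
  fixes f :: "nat \<Rightarrow> nat \<Rightarrow> real"
  shows "(\<Sum>i<n * d. f (i div d) (i mod d)) = (\<Sum>u<n. \<Sum>a<d. f u a)"
proof -
  have "(\<Sum>u<n. \<Sum>a<d. f u a) = (\<Sum>u<n. sum (\<lambda>i. f (i div d) (i mod d)) {u * d..<u * d + d})"
  proof (rule sum.cong[OF refl])
    fix u
    have "sum (\<lambda>i. f (i div d) (i mod d)) {0 + u * d..<d + u * d} = (\<Sum>a<d. f u a)"
      unfolding sum.shift_bounds_nat_ivl atLeast0LessThan by (intro sum.cong) auto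
    then show "(\<Sum>a<d. f u a) = sum (\<lambda>i. f (i div d) (i mod d)) {u * d..<u * d + d}"
      by (simp add: add.commute)
  qed
  then show ?thesis by (simp add: sum.nat_group)
qed

definition gram :: "nat \<Rightarrow> 'a freq \<Rightarrow> (nat \<Rightarrow> 'a) \<Rightarrow> quat mat" where
  "gram n \<rho> h = stacked n \<rho> h * qadj (stacked n \<rho> h)"

lemma stacked_carrier [simp]: "stacked n \<rho> h \<in> carrier_mat (n * fdim \<rho>) (fdim \<rho>)"
  by (simp add: stacked_def)

lemma gram_carrier [simp]: "gram n \<rho> h \<in> carrier_mat (n * fdim \<rho>) (n * fdim \<rho>)"
  unfolding gram_def by (rule mult_carrier_mat[OF stacked_carrier qadj_carrier[OF stacked_carrier]])

lemma gram_hermitian: "qadj (gram n \<rho> h) = gram n \<rho> h"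
  unfolding gram_def by (simp add: qadj_mult[OF stacked_carrier qadj_carrier[OF stacked_carrier]] qadj_qadj)

text \<open>The Gram matrix consists of n^2 blocks \<open>?U u v\<close>. Each is a product of
  unitary matrices, hence unitary, and has squared norm d by \<open>frob_unitary\<close>.\<close>

lemma frob_gram:
  assumes "unitary_rep G \<rho>" and h: "\<And>u. u < n \<Longrightarrow> h u \<in> carrier G"
  shows "frob (gram n \<rho> h) (gram n \<rho> h) = (real n)\<^sup>2 * fdim \<rho>"
proof -
  let ?d = "fdim \<rho>" and ?R = "\<lambda>u. frep \<rho> (h u)"
  let ?U = "\<lambda>u v. ?R u * qadj (?R v)"
  let ?q = "\<lambda>u a v b. qinner (?U u v $$ (a, b)) (?U u v $$ (a, b))"
  have R: "?R u \<in> carrier_mat ?d ?d" "?R u * qadj (?R u) = 1\<^sub>m ?d" "qadj (?R u) * ?R u = 1\<^sub>m ?d"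
    if "u < n" for u
    using assms h[OF that] by (auto simp: unitary_rep_def)
  have block: "frob (?U u v) (?U u v) = ?d" if "u < n" "v < n" for u v
  proof (rule frob_unitary)
    note Ru = R[OF that(1)] and Rv = R[OF that(2)]
    note q = qadj_carrier[OF Ru(1)] qadj_carrier[OF Rv(1)]
    show "?U u v \<in> carrier_mat ?d ?d" using Ru(1) q(2) by simp
    have "?U u v * qadj (?U u v) = ?R u * (qadj (?R v) * (?R v * qadj (?R u)))"
      unfolding qadj_mult[OF Ru(1) q(2)] qadj_qadj
      by (rule assoc_mult_mat[OF Ru(1) q(2) mult_carrier_mat[OF Rv(1) q(1)]])
    also have "qadj (?R v) * (?R v * qadj (?R u)) = (qadj (?R v) * ?R v) * qadj (?R u)"
      by (rule assoc_mult_mat[symmetric, OF q(2) Rv(1) q(1)])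
    finally show "?U u v * qadj (?U u v) = 1\<^sub>m ?d" using Ru Rv q by simp
  qed
  have entry: "gram n \<rho> h $$ (i, j) = ?U (i div ?d) (j div ?d) $$ (i mod ?d, j mod ?d)"
    if "i < n * ?d" "j < n * ?d" for i j
  proof -
    have "?d > 0" using that by (cases ?d) auto
    then have dm: "i mod ?d < ?d" "j mod ?d < ?d" by auto
    have "i div ?d < n" "j div ?d < n" using that by (auto simp: less_mult_imp_div_less)
    note this[THEN R(1)]
    then show ?thesis using that dm
      by (auto simp: gram_def stacked_def qadj_def scalar_prod_def)
  qed
  have "frob (gram n \<rho> h) (gram n \<rho> h) =
      (\<Sum>i<n * ?d. \<Sum>j<n * ?d. qinner (gram n \<rho> h $$ (i, j)) (gram n \<rho> h $$ (i, j)))"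
    by (simp add: frob_def sum.cartesian_product' carrier_matD[OF gram_carrier])
  also have "\<dots> = (\<Sum>i<n * ?d. \<Sum>j<n * ?d. ?q (i div ?d) (i mod ?d) (j div ?d) (j mod ?d))"
    by (intro sum.cong) (auto simp: entry)
  also have "\<dots> = (\<Sum>i<n * ?d. \<Sum>v<n. \<Sum>b<?d. ?q (i div ?d) (i mod ?d) v b)"
    by (rule sum.cong[OF refl], rule sum_div_mod)
  also have "\<dots> = (\<Sum>u<n. \<Sum>a<?d. \<Sum>v<n. \<Sum>b<?d. ?q u a v b)"
    by (rule sum_div_mod)
  also have "\<dots> = (\<Sum>u<n. \<Sum>v<n. \<Sum>a<?d. \<Sum>b<?d. qinner (?U u v $$ (a, b)) (?U u v $$ (a, b)))"
    by (intro sum.cong[OF refl] sum.swap)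
  also have "\<dots> = (\<Sum>u<n. \<Sum>v<n. frob (?U u v) (?U u v))"
    by (intro sum.cong refl) (simp add: frob_def sum.cartesian_product' R(1)[THEN carrier_matD(1)])
  also have "\<dots> = (real n)\<^sup>2 * ?d" by (simp add: block power2_eq_square)
  finally show ?thesis .
qed

section \<open>Reduction of Hermitian matrices to their upper triangle\<close>

text \<open>Reflection maps the strict lower triangle onto the strict upper one, whose terms
  therefore count twice. Only entries on and above the diagonal are drawn independently, so noise
  sums must be brought to this form.\<close>

lemma sum_symmetric:
  fixes f :: "nat \<times> nat \<Rightarrow> real"
  assumes "\<And>i j. i < m \<Longrightarrow> j < m \<Longrightarrow> f (j, i) = f (i, j)"
  shows "(\<Sum>p\<in>{..<m} \<times> {..<m}. f p) =
    (\<Sum>(i, j)\<in>{(i, j). i \<le> j \<and> j < m}. (if i = j then 1 else 2) * f (i, j))"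
proof -
  let ?D = "{(i, j). i = j \<and> j < m}" and ?U = "{(i, j). i < j \<and> j < m}"
    and ?L = "{(i, j). j < i \<and> i < m}"
  have fin: "finite ?D" "finite ?U" "finite ?L"
    by (rule finite_subset[of _ "{..<m} \<times> {..<m}"]; auto)+
  have "(\<Sum>p\<in>{..<m} \<times> {..<m}. f p) = sum f (?D \<union> (?U \<union> ?L))"
    by (rule sum.cong) auto
  also have "\<dots> = sum f ?D + (sum f ?U + sum f ?L)"
    using fin by (subst sum.union_disjoint; (subst sum.union_disjoint)?) auto
  also have "sum f ?L = sum f ?U"
    by (rule sum.reindex_bij_witness[of _ prod.swap prod.swap]) (auto simp: assms)
  also have "sum f ?D + (sum f ?U + sum f ?U) =
      (\<Sum>(i, j)\<in>?D. (if i = j then 1 else 2) * f (i, j))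
      + (\<Sum>(i, j)\<in>?U. (if i = j then 1 else 2) * f (i, j))"
    by (intro arg_cong2[of _ _ _ _ "(+)"])
      (auto simp: sum_distrib_left mult_2[symmetric] intro!: sum.cong)
  also have "\<dots> = (\<Sum>(i, j)\<in>?D \<union> ?U. (if i = j then 1 else 2) * f (i, j))"
    using fin by (subst sum.union_disjoint) auto
  also have "?D \<union> ?U = {(i, j). i \<le> j \<and> j < m}" by auto
  finally show ?thesis .
qed

lemma hermitian_entry: "qadj M = M \<Longrightarrow> M \<in> carrier_mat m m \<Longrightarrow> i < m \<Longrightarrow> j < m \<Longrightarrow>
    M $$ (j, i) = qcnj (M $$ (i, j))"
  by (metis carrier_matD index_mat(1) old.prod.case qadj_def)


text \<open>Conjugating both arguments preserves \<open>qinner\<close>, so mirrored entries give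
  equal terms. The first formula is a linear form in the independent entries of \<open>w\<close>;
  the second shows the same weights 1 and 2 in the squared norm.\<close>

lemma frob_symmetric:
  assumes "M \<in> carrier_mat m m" "qadj M = M"
  shows "frob (hermitian_of m w) M = (\<Sum>(i, j)\<in>{(i, j). i \<le> j \<and> j < m}.
      (if i = j then 1 else 2) * qinner (w (i, j)) (M $$ (i, j)))"
    and "frob M M = (\<Sum>(i, j)\<in>{(i, j). i \<le> j \<and> j < m}.
      (if i = j then 1 else 2) * qinner (M $$ (i, j)) (M $$ (i, j)))"
proof -
  note M = hermitian_entry[OF assms(2,1)]
  have "frob (hermitian_of m w) M =
      (\<Sum>p\<in>{..<m} \<times> {..<m}. qinner (hermitian_of m w $$ p) (M $$ p))"
    using assms by (simp add: frob_def)
  also have "\<dots> = (\<Sum>(i, j)\<in>{(i, j). i \<le> j \<and> j < m}.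
      (if i = j then 1 else 2) * qinner (hermitian_of m w $$ (i, j)) (M $$ (i, j)))"
  proof (rule sum_symmetric)
    fix i j assume *: "i < m" "j < m"
    show "qinner (hermitian_of m w $$ (j, i)) (M $$ (j, i)) =
        qinner (hermitian_of m w $$ (i, j)) (M $$ (i, j))"
    \<comment> \<open>On the diagonal the two sides coincide, even if \<open>w (i, i)\<close> is not
      real.\<close>
    proof (cases i j rule: linorder_cases)
      case less
      then show ?thesis using * by (simp add: hermitian_of_def M[OF *] qinner_qcnj)
    next
      case greater
      then show ?thesis using * by (simp add: hermitian_of_def M[OF *(2,1)] qinner_qcnj)
    qed simp
  qed
  also have "\<dots> = (\<Sum>(i, j)\<in>{(i, j). i \<le> j \<and> j < m}.
      (if i = j then 1 else 2) * qinner (w (i, j)) (M $$ (i, j)))"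
    by (rule sum.cong) (auto simp: hermitian_of_def)
  finally show "frob (hermitian_of m w) M = (\<Sum>(i, j)\<in>{(i, j). i \<le> j \<and> j < m}.
      (if i = j then 1 else 2) * qinner (w (i, j)) (M $$ (i, j)))" .
  have "frob M M = (\<Sum>p\<in>{..<m} \<times> {..<m}. qinner (M $$ p) (M $$ p))"
    using assms by (simp add: frob_def)
  also have "\<dots> = (\<Sum>(i, j)\<in>{(i, j). i \<le> j \<and> j < m}.
      (if i = j then 1 else 2) * qinner (M $$ (i, j)) (M $$ (i, j)))"
  proof (rule sum_symmetric)
    fix i j assume "i < m" "j < m"
    then show "qinner (M $$ (j, i)) (M $$ (j, i)) = qinner (M $$ (i, j)) (M $$ (i, j))"
      by (subst (1 2) M) (simp_all add: qinner_qcnj)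
  qed
  finally show "frob M M = (\<Sum>(i, j)\<in>{(i, j). i \<le> j \<and> j < m}.
      (if i = j then 1 else 2) * qinner (M $$ (i, j)) (M $$ (i, j)))" .
qed

section \<open>Exponential moments of the noise\<close>

text \<open>Completing the square: the factor \<open>exp (s * x)\<close> shifts the mean of the
  density to \<open>s * v\<close>, up to the constant \<open>exp (s\<^sup>2 * v / 2)\<close>, and
  the shifted density has mass 1.\<close>

lemma nn_integral_exp_normal:
  assumes v: "0 < v"
  shows "(\<integral>\<^sup>+x. ennreal (exp (s * x)) \<partial>centred_normal v) = ennreal (exp (s\<^sup>2 * v / 2))"
proof -
  have shift: "normal_density 0 (sqrt v) x * exp (s * x) =
      exp (s\<^sup>2 * v / 2) * normal_density (s * v) (sqrt v) x" for x
  proof -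
    have "- (x - 0)\<^sup>2 / (2 * v) + s * x = s\<^sup>2 * v / 2 + - (x - s * v)\<^sup>2 / (2 * v)"
      using v by (simp add: field_simps power2_eq_square)
    then show ?thesis using v by (simp add: normal_density_def exp_add[symmetric])
  qed
  interpret N: prob_space "density lborel (normal_density (s * v) (sqrt v))"
    using v by (intro prob_space_normal_density) simp
  have "(\<integral>\<^sup>+x. ennreal (exp (s * x)) \<partial>centred_normal v) =
      (\<integral>\<^sup>+x. ennreal (normal_density 0 (sqrt v) x * exp (s * x)) \<partial>lborel)"
    unfolding centred_normal_def by (subst nn_integral_density) (auto simp: ennreal_mult)
  also have "\<dots> = (\<integral>\<^sup>+x. ennreal (exp (s\<^sup>2 * v / 2)) * ennreal (normal_density (s * v) (sqrt v) x) \<partial>lborel)"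
    by (simp add: shift ennreal_mult)
  also have "\<dots> = ennreal (exp (s\<^sup>2 * v / 2)) * (\<integral>\<^sup>+x. ennreal (normal_density (s * v) (sqrt v) x) \<partial>lborel)"
    by (rule nn_integral_cmult) simp
  also have "(\<integral>\<^sup>+x. ennreal (normal_density (s * v) (sqrt v) x) \<partial>lborel) = 1"
    using N.emeasure_space_1 by (simp add: emeasure_density)
  finally show ?thesis by simp
qed

lemma nn_integral_pair_mult:
  assumes [measurable]: "f \<in> borel_measurable M" "g \<in> borel_measurable N" and "sigma_finite_measure N"
  shows "(\<integral>\<^sup>+z. f (fst z) * g (snd z) \<partial>(M \<Otimes>\<^sub>M N)) = (\<integral>\<^sup>+x. f x \<partial>M) * (\<integral>\<^sup>+y. g y \<partial>N)"
proof -
  interpret sigma_finite_measure N by fact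
  have "(\<integral>\<^sup>+z. f (fst z) * g (snd z) \<partial>(M \<Otimes>\<^sub>M N)) = (\<integral>\<^sup>+x. \<integral>\<^sup>+y. f x * g y \<partial>N \<partial>M)"
    by (subst nn_integral_fst[symmetric]) auto
  then show ?thesis by (simp add: nn_integral_cmult nn_integral_multc)
qed

lemma measurable_qinner [measurable]: "(\<lambda>q. qinner q p) \<in> borel_measurable quat_borel"
  unfolding qinner_def by measurable

text \<open>Each of the \<beta> components has variance 1/\<beta> and multiplies the integral by the
  exponential of its share of \<open>s\<^sup>2 * qinner p p / (2 * beta t)\<close>. Components of
  \<open>p\<close> outside \<open>scalars t\<close> meet no noise; including them in
  \<open>qinner p p\<close> only enlarges the bound.\<close>

lemma nn_integral_exp_std_gaussian:
  "(\<integral>\<^sup>+q. ennreal (exp (s * qinner q p)) \<partial>std_gaussian t) \<le>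
    ennreal (exp (s\<^sup>2 * qinner p p / (2 * beta t)))"
proof (cases t)
  case RealType
  have "(\<integral>\<^sup>+q. ennreal (exp (s * qinner q p)) \<partial>std_gaussian t) =
      (\<integral>\<^sup>+a. ennreal (exp ((s * qre p) * a)) \<partial>centred_normal 1)"
    unfolding RealType std_gaussian.simps
    by (subst nn_integral_distr) (auto intro!: measurable_into_quat simp: qinner_def ac_simps)
  also have "\<dots> = ennreal (exp ((s * qre p)\<^sup>2 / 2))"
    by (simp add: nn_integral_exp_normal)
  also have "\<dots> \<le> ennreal (exp (s\<^sup>2 * qinner p p / (2 * beta t)))"
    by (auto simp: RealType qinner_self power_mult_distrib intro!: ennreal_leI mult_left_mono)
  finally show ?thesis .
next
  case ComplexType
  let ?N = "centred_normal (1 / 2)"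
  interpret N: prob_space ?N by (rule prob_space_centred_normal) simp
  have "(\<integral>\<^sup>+q. ennreal (exp (s * qinner q p)) \<partial>std_gaussian t) =
      (\<integral>\<^sup>+z. ennreal (exp ((s * qre p) * fst z)) * ennreal (exp ((s * qi p) * snd z)) \<partial>(?N \<Otimes>\<^sub>M ?N))"
    unfolding ComplexType std_gaussian.simps
    by (subst nn_integral_distr)
      (auto intro!: measurable_into_quat nn_integral_cong simp: case_prod_beta qinner_def
        ennreal_mult[symmetric] exp_add[symmetric] algebra_simps)
  also have "\<dots> = ennreal (exp ((s * qre p)\<^sup>2 / 4)) * ennreal (exp ((s * qi p)\<^sup>2 / 4))"
    by (subst nn_integral_pair_mult) (auto simp: nn_integral_exp_normal N.sigma_finite_measure_axioms)
  also have "\<dots> = ennreal (exp (s\<^sup>2 * ((qre p)\<^sup>2 + (qi p)\<^sup>2) / 4))"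
    by (simp add: ennreal_mult[symmetric] exp_add[symmetric] power_mult_distrib algebra_simps add_divide_distrib)
  also have "\<dots> \<le> ennreal (exp (s\<^sup>2 * qinner p p / (2 * beta t)))"
    by (auto simp: ComplexType qinner_self intro!: ennreal_leI divide_right_mono mult_left_mono)
  finally show ?thesis .
next
  case QuatType
  let ?N = "centred_normal (1 / 4)"
  interpret N: prob_space ?N by (rule prob_space_centred_normal) simp
  have sf: "sigma_finite_measure (?N \<Otimes>\<^sub>M ?N \<Otimes>\<^sub>M ?N)" "sigma_finite_measure (?N \<Otimes>\<^sub>M ?N)"
    by (intro prob_space_imp_sigma_finite prob_space_pair N.prob_space_axioms)+
  let ?e = "\<lambda>c x. ennreal (exp ((s * c) * x))" and ?E = "\<lambda>c. ennreal (exp ((s * c)\<^sup>2 / 8))"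
  \<comment> \<open>Peels one Gaussian coordinate off the nested product measure; applied three
    times, it leaves the product of four one-dimensional integrals.\<close>
  have factor: "(\<integral>\<^sup>+z. ?e c (fst z) * g (snd z) \<partial>(?N \<Otimes>\<^sub>M K)) = ?E c * integral\<^sup>N K g"
    if "g \<in> borel_measurable K" "sigma_finite_measure K" for c g and K :: "'c measure"
    by (subst nn_integral_pair_mult[where f = "?e c"]) (auto simp: nn_integral_exp_normal that)
  let ?g2 = "\<lambda>z. ?e (qj p) (fst z) * ?e (qk p) (snd z)"
  let ?g1 = "\<lambda>z. ?e (qi p) (fst z) * ?g2 (snd z)"
  have "(\<integral>\<^sup>+q. ennreal (exp (s * qinner q p)) \<partial>std_gaussian t) =
      (\<integral>\<^sup>+z. ?e (qre p) (fst z) * ?g1 (snd z) \<partial>(?N \<Otimes>\<^sub>M ?N \<Otimes>\<^sub>M ?N \<Otimes>\<^sub>M ?N))"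
    unfolding QuatType std_gaussian.simps
    by (subst nn_integral_distr)
      (auto intro!: measurable_into_quat nn_integral_cong simp: case_prod_beta qinner_def
        ennreal_mult[symmetric] exp_add[symmetric] algebra_simps)
  also have "\<dots> = ?E (qre p) * integral\<^sup>N (?N \<Otimes>\<^sub>M ?N \<Otimes>\<^sub>M ?N) ?g1"
    by (rule factor[of ?g1]) (use sf in measurable)
  also have "integral\<^sup>N (?N \<Otimes>\<^sub>M ?N \<Otimes>\<^sub>M ?N) ?g1 = ?E (qi p) * integral\<^sup>N (?N \<Otimes>\<^sub>M ?N) ?g2"
    by (rule factor[of ?g2]) (use sf in measurable)
  also have "integral\<^sup>N (?N \<Otimes>\<^sub>M ?N) ?g2 = ?E (qj p) * ?E (qk p)"
    by (subst factor[of "?e (qk p)"])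
      (auto simp: nn_integral_exp_normal N.sigma_finite_measure_axioms)
  also have "?E (qre p) * (?E (qi p) * (?E (qj p) * ?E (qk p))) =
      ennreal (exp (s\<^sup>2 * qinner p p / (2 * beta t)))"
    by (simp add: QuatType qinner_self ennreal_mult[symmetric] exp_add[symmetric] power_mult_distrib
      algebra_simps add_divide_distrib)
  finally show ?thesis by simp
qed

text \<open>A real Gaussian of variance 2/\<beta> sees only \<open>qre p\<close>. The doubled
  variance doubles the exponent compared with \<open>nn_integral_exp_std_gaussian\<close>.\<close>

lemma nn_integral_exp_diag_gaussian:
  "(\<integral>\<^sup>+q. ennreal (exp (s * qinner q p)) \<partial>diag_gaussian t) \<le>
    ennreal (exp (s\<^sup>2 * qinner p p / beta t))"
proof -
  have b: "0 < real (beta t)" by (cases t) auto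
  have "(\<integral>\<^sup>+q. ennreal (exp (s * qinner q p)) \<partial>diag_gaussian t) =
      (\<integral>\<^sup>+a. ennreal (exp ((s * qre p) * a)) \<partial>centred_normal (2 / beta t))"
    unfolding diag_gaussian_def
    by (subst nn_integral_distr)
      (auto intro!: measurable_into_quat simp: qinner_def of_real_quat ac_simps)
  also have "\<dots> = ennreal (exp (s\<^sup>2 * (qre p)\<^sup>2 / beta t))"
    using b by (simp add: nn_integral_exp_normal power_mult_distrib)
  also have "\<dots> \<le> ennreal (exp (s\<^sup>2 * qinner p p / beta t))"
    by (auto simp: qinner_self intro!: ennreal_leI divide_right_mono mult_left_mono)
  finally show ?thesis .
qed

section \<open>Exponential moments of a whole GOE, GUE or GSE matrix\<close>

lemma measurable_frob:
  assumes "B \<in> carrier_mat m m"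
  shows "(\<lambda>A. frob A B) \<in> borel_measurable (qmat_borel m)"
  unfolding frob_def
  by (rule borel_measurable_sum)
    (use assms in \<open>auto intro!: measurable_compose[OF measurable_qmat_entry measurable_qinner]\<close>)

lemma measurable_hermitian_of:
  assumes "\<And>i j. i \<le> j \<Longrightarrow> j < m \<Longrightarrow> sets (N (i, j)) = sets quat_borel"
  shows "hermitian_of m \<in> measurable (\<Pi>\<^sub>M p\<in>{(i, j). i \<le> j \<and> j < m}. N p) (qmat_borel m)"
proof (rule measurable_into_qmat)
  let ?P = "\<Pi>\<^sub>M p\<in>{(i, j). i \<le> j \<and> j < m}. N p"
  have comp: "(\<lambda>w. w (i, j)) \<in> measurable ?P quat_borel" if "i \<le> j" "j < m" for i j
    using that assms[OF that] measurable_component_singleton[of "(i, j)" "{(i, j). i \<le> j \<and> j < m}" N]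
    by (simp cong: measurable_cong_sets)
  fix i j assume ij: "i < m" "j < m"
  show "(\<lambda>w. hermitian_of m w $$ (i, j)) \<in> measurable ?P quat_borel"
    using ij comp[of i j] measurable_quat_ops(3)[OF comp comp, of j i j i]
    by (cases "i \<le> j") (simp_all add: hermitian_of_def)
qed (simp add: hermitian_of_def)

text \<open>By \<open>frob_symmetric\<close> the exponent is a sum over independent entries, so the
  integral factorises. The diagonal variance 2/\<beta> is exactly what makes the exponents recombine
  into \<open>frob M M\<close>.\<close>

lemma nn_integral_exp_ensemble:
  assumes M: "M \<in> carrier_mat m m" "qadj M = M"
  shows "(\<integral>\<^sup>+W. ennreal (exp (s * frob W M)) \<partial>gaussian_ensemble t m) \<le>
    ennreal (exp (s\<^sup>2 * frob M M / beta t))"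
proof -
  let ?I = "{(i, j). i \<le> j \<and> j < m}"
  let ?N = "\<lambda>(i :: nat, j). if i = j then diag_gaussian t else std_gaussian t"
  let ?k = "\<lambda>p. if fst p = snd p then 1 else 2 :: real"
  let ?f = "\<lambda>p q. ennreal (exp ((s * ?k p) * qinner q (M $$ p)))"
  have fin: "finite ?I"
    by (rule finite_subset[of _ "{..<m} \<times> {..<m}"]) auto
  have sets_N: "sets (?N p) = sets quat_borel" for p
    by (simp add: case_prod_beta)
  interpret product_sigma_finite ?N
    by (rule product_sigma_finite.intro) (simp add: case_prod_beta prob_space_imp_sigma_finite
      prob_space_diag_gaussian prob_space_std_gaussian)
  have herm: "hermitian_of m \<in> measurable (PiM ?I ?N) (qmat_borel m)"
    by (rule measurable_hermitian_of) simp
  have "(\<integral>\<^sup>+W. ennreal (exp (s * frob W M)) \<partial>gaussian_ensemble t m) =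
      (\<integral>\<^sup>+w. ennreal (exp (s * frob (hermitian_of m w) M)) \<partial>PiM ?I ?N)"
    unfolding gaussian_ensemble_def using measurable_frob[OF M(1)]
    by (intro nn_integral_distr[OF herm]) measurable
  also have "\<dots> = (\<integral>\<^sup>+w. (\<Prod>p\<in>?I. ?f p (w p)) \<partial>PiM ?I ?N)"
  proof (rule nn_integral_cong)
    fix w
    have "s * frob (hermitian_of m w) M = (\<Sum>p\<in>?I. (s * ?k p) * qinner (w p) (M $$ p))"
      unfolding frob_symmetric(1)[OF M] sum_distrib_left by (rule sum.cong) auto
    then show "ennreal (exp (s * frob (hermitian_of m w) M)) = (\<Prod>p\<in>?I. ?f p (w p))"
      using fin by (simp add: exp_sum prod_ennreal)
  qed
  also have "\<dots> = (\<Prod>p\<in>?I. integral\<^sup>N (?N p) (?f p))"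
    by (rule product_nn_integral_prod[OF fin]) (simp cong: measurable_cong_sets add: sets_N)
  also have "\<dots> \<le> (\<Prod>p\<in>?I. ennreal (exp (s\<^sup>2 * (?k p * qinner (M $$ p) (M $$ p)) / beta t)))"
  proof (rule prod_mono_ennreal)
    fix p
    show "integral\<^sup>N (?N p) (?f p) \<le>
        ennreal (exp (s\<^sup>2 * (?k p * qinner (M $$ p) (M $$ p)) / beta t))"
      \<comment> \<open>Off the diagonal the weight 2 gives
        \<open>(s * 2)\<^sup>2 / (2 * beta t) = 2 * s\<^sup>2 / beta t\<close>; on it the weight 1
        gives \<open>s\<^sup>2 / beta t\<close>. Both are \<open>?k p\<close> times the same
        constant.\<close>
      using nn_integral_exp_diag_gaussian[where s = s and p = "M $$ p" and t = t]
        nn_integral_exp_std_gaussian[where s = "s * 2" and p = "M $$ p" and t = t]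
      by (auto simp: case_prod_beta power_mult_distrib mult.left_commute)
  qed
  also have "\<dots> = ennreal (exp (\<Sum>p\<in>?I. s\<^sup>2 * (?k p * qinner (M $$ p) (M $$ p)) / beta t))"
    using fin by (simp add: exp_sum prod_ennreal)
  also have "(\<Sum>p\<in>?I. s\<^sup>2 * (?k p * qinner (M $$ p) (M $$ p)) / beta t) = s\<^sup>2 * frob M M / beta t"
    unfolding frob_symmetric(2)[OF M] sum_distrib_left sum_divide_distrib by (rule sum.cong) auto
  finally show ?thesis .
qed

section \<open>The maximum likelihood statistic\<close>

text \<open>The weights are a parameter because the same functional is applied to observations, to
  noise with rescaled weights, and to noise with negated weights for a lower tail.\<close>

definition stat :: "('a freq \<Rightarrow> real) \<Rightarrow> nat \<Rightarrow> 'a freq set \<Rightarrow> (nat \<Rightarrow> 'a) \<Rightarrow>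
    ('a freq \<Rightarrow> quat mat) \<Rightarrow> real" where
  "stat c n \<Psi> h Y = (\<Sum>\<rho>\<in>\<Psi>. c \<rho> * frob (Y \<rho>) (gram n \<rho> h))"

definition noise :: "nat \<Rightarrow> 'a freq set \<Rightarrow> ('a freq \<Rightarrow> quat mat) measure" where
  "noise n \<Psi> = (\<Pi>\<^sub>M \<rho>\<in>\<Psi>. gaussian_ensemble (ftype \<rho>) (n * fdim \<rho>))"

lemma sets_noise [measurable_cong]: "sets (noise n \<Psi>) = sets (obs_space n \<Psi>)"
  unfolding noise_def obs_space_def by (rule sets_PiM_cong) auto

lemma space_noise: "space (noise n \<Psi>) = space (obs_space n \<Psi>)"
  by (rule sets_eq_imp_space_eq) (rule sets_noise)

lemma prob_space_noise: "prob_space (noise n \<Psi>)"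
  unfolding noise_def by (intro prob_space_PiM prob_space_gaussian_ensemble)

lemma measurable_stat [measurable]: "stat c n \<Psi> h \<in> borel_measurable (obs_space n \<Psi>)"
  unfolding stat_def obs_space_def
proof (intro borel_measurable_sum borel_measurable_times borel_measurable_const)
  fix \<rho> assume "\<rho> \<in> \<Psi>"
  from measurable_compose[OF measurable_component_singleton[OF this] measurable_frob[OF gram_carrier]]
  show "(\<lambda>Y. frob (Y \<rho>) (gram n \<rho> h)) \<in>
      borel_measurable (\<Pi>\<^sub>M \<rho>\<in>\<Psi>. qmat_borel (n * fdim \<rho>))" .
qed

text \<open>The noise matrices are independent across frequencies, so the bounds of
  \<open>nn_integral_exp_ensemble\<close> multiply and their exponents add.\<close>

lemma nn_integral_exp_stat:
  assumes fin: "finite \<Psi>"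
  shows "(\<integral>\<^sup>+W. ennreal (exp (s * stat c n \<Psi> h W)) \<partial>noise n \<Psi>) \<le>
    ennreal (exp (s\<^sup>2 * (\<Sum>\<rho>\<in>\<Psi>. (c \<rho>)\<^sup>2 * frob (gram n \<rho> h) (gram n \<rho> h) / beta (ftype \<rho>))))"
proof -
  let ?M = "\<lambda>\<rho>. gram n \<rho> h" and ?N = "\<lambda>\<rho>. gaussian_ensemble (ftype \<rho>) (n * fdim \<rho>)"
  let ?f = "\<lambda>\<rho> A. ennreal (exp ((s * c \<rho>) * frob A (?M \<rho>)))"
  interpret product_sigma_finite ?N
    by (intro product_sigma_finite.intro prob_space_imp_sigma_finite prob_space_gaussian_ensemble)
  have "(\<integral>\<^sup>+W. ennreal (exp (s * stat c n \<Psi> h W)) \<partial>noise n \<Psi>) =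
      (\<integral>\<^sup>+W. (\<Prod>\<rho>\<in>\<Psi>. ?f \<rho> (W \<rho>)) \<partial>PiM \<Psi> ?N)"
    unfolding noise_def stat_def
    by (simp add: sum_distrib_left exp_sum[OF fin] prod_ennreal mult.assoc)
  also have "\<dots> = (\<Prod>\<rho>\<in>\<Psi>. integral\<^sup>N (?N \<rho>) (?f \<rho>))"
  proof (rule product_nn_integral_prod[OF fin])
    fix \<rho>
    have [measurable]: "(\<lambda>A. frob A (?M \<rho>)) \<in> borel_measurable (?N \<rho>)"
      using measurable_frob[OF gram_carrier] by (simp cong: measurable_cong_sets)
    show "?f \<rho> \<in> borel_measurable (?N \<rho>)" by measurable
  qed
  also have "\<dots> \<le> (\<Prod>\<rho>\<in>\<Psi>. ennreal (exp ((s * c \<rho>)\<^sup>2 * frob (?M \<rho>) (?M \<rho>) / beta (ftype \<rho>))))"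
    by (intro prod_mono_ennreal nn_integral_exp_ensemble gram_carrier gram_hermitian)
  also have "\<dots> = ennreal (exp (s\<^sup>2 * (\<Sum>\<rho>\<in>\<Psi>. (c \<rho>)\<^sup>2 * frob (?M \<rho>) (?M \<rho>) / beta (ftype \<rho>))))"
    by (simp add: sum_distrib_left exp_sum[OF fin] prod_ennreal power_mult_distrib mult.assoc)
  finally show ?thesis .
qed

section \<open>Chernoff bound and transfer from noise to the model\<close>

text \<open>Exponential Markov inequality: by \<open>V\<close> and
  \<open>nn_integral_exp_stat\<close> the statistic behaves like a centred Gaussian of variance at
  most 2 n S, whence the exponent \<open>- n * x\<^sup>2 / (4 * S)\<close>.\<close>

lemma stat_tail:
  assumes fin: "finite \<Psi>" and S: "0 < S" and x: "0 \<le> x"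
    and V: "(\<Sum>\<rho>\<in>\<Psi>. (c \<rho>)\<^sup>2 * frob (gram n \<rho> h) (gram n \<rho> h) / beta (ftype \<rho>)) \<le> n * S"
  shows "emeasure (noise n \<Psi>) {W \<in> space (noise n \<Psi>). n * x \<le> stat c n \<Psi> h W} \<le>
    ennreal (exp (- (x\<^sup>2 / (4 * S))) ^ n)"
proof -
  let ?A = "{W \<in> space (noise n \<Psi>). n * x \<le> stat c n \<Psi> h W}"
  \<comment> \<open>the minimiser of the Chernoff exponent \<open>s\<^sup>2 n S - s n x\<close>\<close>
  define s where "s = x / (2 * S)"
  have s: "0 \<le> s" using S x by (simp add: s_def)
  have A: "?A \<in> sets (noise n \<Psi>)" by measurable
  have "emeasure (noise n \<Psi>) ?A = (\<integral>\<^sup>+W. indicator ?A W \<partial>noise n \<Psi>)"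
    using A by simp
  also have "\<dots> \<le> (\<integral>\<^sup>+W. ennreal (exp (- (s * (n * x)))) * ennreal (exp (s * stat c n \<Psi> h W)) \<partial>noise n \<Psi>)"
  proof (rule nn_integral_mono)
    fix W
    have "1 \<le> exp (- (s * (n * x))) * exp (s * stat c n \<Psi> h W)" if "W \<in> ?A"
      using that s by (simp add: exp_add[symmetric] mult_left_mono)
    then show "indicator ?A W \<le> ennreal (exp (- (s * (n * x)))) * ennreal (exp (s * stat c n \<Psi> h W))"
      by (auto simp: indicator_def ennreal_mult[symmetric] simp flip: ennreal_1 intro!: ennreal_leI)
  qed
  also have "\<dots> = ennreal (exp (- (s * (n * x)))) * (\<integral>\<^sup>+W. ennreal (exp (s * stat c n \<Psi> h W)) \<partial>noise n \<Psi>)"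
    by (rule nn_integral_cmult) measurable
  also have "\<dots> \<le> ennreal (exp (- (s * (n * x)))) * ennreal (exp (s\<^sup>2 * (n * S)))"
    using V by (intro mult_left_mono order_trans[OF nn_integral_exp_stat[OF fin]] ennreal_leI)
      (auto intro: mult_left_mono)
  also have "\<dots> = ennreal (exp (n * - (x\<^sup>2 / (4 * S))))"
  proof -
    have "- (s * (n * x)) + s\<^sup>2 * (n * S) = n * - (x\<^sup>2 / (4 * S))"
      using S by (simp add: s_def field_simps power2_eq_square)
    then show ?thesis by (simp add: ennreal_mult[symmetric] exp_add[symmetric])
  qed
  finally show ?thesis by (simp only: exp_of_nat_mult)
qed

text \<open>Linearity of \<open>frob\<close> separates the deterministic signal of the truth
  \<open>g\<close> at the candidate \<open>h\<close> from the noise, whose scaling is absorbed into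
  the weights.\<close>

lemma stat_spiked:
  assumes "W \<in> space (noise n \<Psi>)"
  shows "stat c n \<Psi> h (\<lambda>\<rho>\<in>\<Psi>. spiked n (lam \<rho>) \<rho> g (W \<rho>)) =
    (\<Sum>\<rho>\<in>\<Psi>. c \<rho> * (lam \<rho> / n) * frob (gram n \<rho> g) (gram n \<rho> h))
    + stat (\<lambda>\<rho>. c \<rho> / sqrt (n * fdim \<rho>)) n \<Psi> h W"
proof -
  have "W \<rho> \<in> carrier_mat (n * fdim \<rho>) (n * fdim \<rho>)" if "\<rho> \<in> \<Psi>" for \<rho>
    using assms that by (auto simp: space_noise obs_space_def space_PiM)
  then show ?thesis unfolding stat_def spiked_def gram_def[symmetric]
    by (simp add: frob_linear[OF gram_carrier _ gram_carrier] algebra_simps sum.distrib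
      del: of_real_divide)
qed

text \<open>
  The map \<open>?f\<close> of the proof need not be shown measurable: a \<open>distr\<close> known to be a probability measure
  is not the degenerate one, so it assigns to each set the \<open>emeasure\<close> of its preimage, which is
  \<open>0\<close> by convention should the preimage be non-measurable.
\<close>

lemma emeasure_gsynch_le:
  assumes fin: "finite (carrier G)" "carrier G \<noteq> {}" and A: "A \<in> sets (obs_space n \<Psi>)"
    and bound: "\<And>g. (\<And>u. u < n \<Longrightarrow> g u \<in> carrier G) \<Longrightarrow>
      \<exists>B\<in>sets (noise n \<Psi>). emeasure (noise n \<Psi>) B \<le> b \<and>
        {W \<in> space (noise n \<Psi>). (\<lambda>\<rho>\<in>\<Psi>. spiked n (lam \<rho>) \<rho> g (W \<rho>)) \<in> A} \<subseteq> B"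
  shows "emeasure (gsynch n lam G \<Psi>) A \<le> b"
proof -
  let ?P = "\<Pi>\<^sub>M u\<in>{..<n}. uniform_count_measure (carrier G)"
  let ?f = "\<lambda>(g, W). \<lambda>\<rho>\<in>\<Psi>. spiked n (lam \<rho>) \<rho> g (W \<rho>)"
  let ?X = "?f -` A \<inter> space (?P \<Otimes>\<^sub>M noise n \<Psi>)"
  have eq: "gsynch n lam G \<Psi> = distr (?P \<Otimes>\<^sub>M noise n \<Psi>) (obs_space n \<Psi>) ?f"
    unfolding gsynch_def noise_def ..
  interpret prob_space "gsynch n lam G \<Psi>" by (rule prob_space_gsynch[OF fin])
  interpret N: prob_space "noise n \<Psi>" by (rule prob_space_noise)
  interpret P: prob_space ?P
    by (intro prob_space_PiM prob_space_uniform_count_measure fin)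
  have le: "emeasure (gsynch n lam G \<Psi>) A \<le> emeasure (?P \<Otimes>\<^sub>M noise n \<Psi>) ?X"
    unfolding eq distr_def emeasure_measure_of_conv by simp
  show ?thesis
  proof (cases "?X \<in> sets (?P \<Otimes>\<^sub>M noise n \<Psi>)")
    case False
    then show ?thesis using le by (simp add: emeasure_notin_sets)
  next
    case True
    \<comment> \<open>Condition on the group elements: the mass is the average of the slice masses,
      and each slice lies in the measurable set \<open>B\<close> supplied by \<open>bound\<close>
      for that \<open>g\<close>.\<close>
    have "emeasure (?P \<Otimes>\<^sub>M noise n \<Psi>) ?X = (\<integral>\<^sup>+g. emeasure (noise n \<Psi>) (Pair g -` ?X) \<partial>?P)"
      by (rule N.emeasure_pair_measure_alt[OF True])
    also have "\<dots> \<le> (\<integral>\<^sup>+g. b \<partial>?P)"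
    proof (rule nn_integral_mono)
      fix g assume "g \<in> space ?P"
      then have "\<And>u. u < n \<Longrightarrow> g u \<in> carrier G"
        by (auto simp: space_PiM space_uniform_count_measure)
      from bound[of g, OF this] obtain B where B: "B \<in> sets (noise n \<Psi>)" "emeasure (noise n \<Psi>) B \<le> b"
        "{W \<in> space (noise n \<Psi>). (\<lambda>\<rho>\<in>\<Psi>. spiked n (lam \<rho>) \<rho> g (W \<rho>)) \<in> A} \<subseteq> B"
        by auto
      then have "Pair g -` ?X \<subseteq> B" by (auto simp: space_pair_measure)
      from emeasure_mono[OF this B(1)] B(2)
      show "emeasure (noise n \<Psi>) (Pair g -` ?X) \<le> b" by (rule order_trans)
    qed
    also have "\<dots> = b" by (simp add: P.emeasure_space_1)
    finally show ?thesis using le by (rule order_trans[rotated])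
  qed
qed

section \<open>Threshold, weights and the two error bounds\<close>

theorem theorem6p18:
  fixes G :: "('a, 'b) monoid_scheme" and L :: nat
    and \<Psi> :: "'a freq set" and lam :: "'a freq \<Rightarrow> real"
  assumes "group G" and "finite (carrier G)" and "order G = L"
    and "frequency_list G \<Psi>"
    and "\<And>\<rho>. \<rho> \<in> \<Psi> \<Longrightarrow> 0 \<le> lam \<rho>"
    and "(\<Sum>\<rho>\<in>\<Psi>. (lam \<rho>)\<^sup>2 * real (beta (ftype \<rho>)) * (real (fdim \<rho>))\<^sup>2) > 4 * ln (real L)"
  shows "\<exists>test :: nat \<Rightarrow> ('a freq \<Rightarrow> quat mat) \<Rightarrow> bool.
    (\<forall>n. test n \<in> measurable (obs_space n \<Psi>) (count_space UNIV)) \<and>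
    (\<lambda>n. measure (gsynch n (\<lambda>_. 0) G \<Psi>) {Y \<in> space (obs_space n \<Psi>). test n Y})
      \<longlonglongrightarrow> 0 \<and>
    (\<lambda>n. measure (gsynch n lam G \<Psi>) {Y \<in> space (obs_space n \<Psi>). \<not> test n Y})
      \<longlonglongrightarrow> 0"
proof -
  define S where "S = (\<Sum>\<rho>\<in>\<Psi>. (lam \<rho>)\<^sup>2 * real (beta (ftype \<rho>)) * (real (fdim \<rho>))\<^sup>2)"
  have ne: "carrier G \<noteq> {}" using assms(1) group.is_monoid monoid.one_closed by fastforce
  then have L: "1 \<le> L" using assms(2,3) by (auto simp: order_def Suc_le_eq card_gt_0_iff)
  have S4: "4 * ln (real L) < S" using assms(6) by (simp add: S_def)
  have lnL: "0 \<le> ln (real L)" using L by simp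
  have S: "0 < S" using S4 lnL by linarith
  \<comment> \<open>Multiplying \<open>S4\<close> by \<open>S\<close> and taking roots shows that
    the interval for the threshold \<open>t\<close> is nonempty.\<close>
  have "sqrt (4 * ln (real L) * S) < sqrt (S * S)"
    using S4 S by (intro real_sqrt_less_mono mult_strict_right_mono)
  then have "sqrt (4 * ln (real L) * S) < S" using S by simp
  then obtain t where t: "sqrt (4 * ln (real L) * S) < t" "t < S" using dense by blast
  have t0: "0 \<le> t" using t(1) lnL S by (smt (verit) mult_nonneg_nonneg real_sqrt_ge_zero)
  have "4 * ln (real L) * S < t\<^sup>2"
    using t(1) t0 real_sqrt_less_iff[of "4 * ln (real L) * S" "t\<^sup>2"] by simp
  \<comment> \<open>The decay rate of a single noise tail exceeds the growth rate of the number of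
    candidates.\<close>
  then have tL: "ln (real L) < t\<^sup>2 / (4 * S)" using S by (simp add: field_simps)

  have fin: "finite \<Psi>" and unitary: "\<And>\<rho>. \<rho> \<in> \<Psi> \<Longrightarrow> unitary_rep G \<rho>"
    using assms(4) by (auto simp: frequency_list_def frequency_def)
  have beta_pos: "0 < real (beta t)" for t by (cases t) auto

  \<comment> \<open>These are the likelihood weights: the Gaussian log-density of
    \<open>Y \<rho>\<close> has cross term \<lambda> \<beta> d / 2 times
    \<open>frob (Y \<rho>) (gram n \<rho> h)\<close>, and its quadratic terms do not depend on
    \<open>h\<close> by \<open>frob_gram\<close>.\<close>
  define c where "c = (\<lambda>\<rho>. lam \<rho> * beta (ftype \<rho>) * fdim \<rho>)"
  define e where "e = (\<lambda>n \<rho>. c \<rho> / sqrt (n * fdim \<rho>))"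
  \<comment> \<open>Extensional functions, so that there are exactly L^n candidates.\<close>
  define H where "H = (\<lambda>n::nat. {..<n} \<rightarrow>\<^sub>E carrier G)"
  define test where "test = (\<lambda>n Y. \<exists>h\<in>H n. n * t \<le> stat c n \<Psi> h Y)"

  have finH: "finite (H n)" and cardH: "card (H n) = L ^ n" for n
    using assms(2,3) by (auto simp: H_def finite_PiE card_PiE order_def)
  have meas [measurable]: "test n \<in> measurable (obs_space n \<Psi>) (count_space UNIV)" for n
    unfolding test_def using finH[of n] by measurable
  have noise_var: "(\<Sum>\<rho>\<in>\<Psi>. (e n \<rho>)\<^sup>2 * frob (gram n \<rho> h) (gram n \<rho> h) / beta (ftype \<rho>)) \<le> n * S"
    if h: "\<And>u. u < n \<Longrightarrow> h u \<in> carrier G" for n h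
    unfolding S_def sum_distrib_left
  proof (rule sum_mono)
    fix \<rho> assume r: "\<rho> \<in> \<Psi>"
    have fg: "frob (gram n \<rho> h) (gram n \<rho> h) = (real n)\<^sup>2 * fdim \<rho>"
      by (rule frob_gram[OF unitary[OF r]]) (erule h)
    show "(e n \<rho>)\<^sup>2 * frob (gram n \<rho> h) (gram n \<rho> h) / beta (ftype \<rho>) \<le>
        n * ((lam \<rho>)\<^sup>2 * beta (ftype \<rho>) * (real (fdim \<rho>))\<^sup>2)"
      unfolding fg e_def c_def using beta_pos[of "ftype \<rho>"]
      \<comment> \<open>If \<open>n * fdim \<rho>\<close> is 0, so is \<open>e n \<rho>\<close>, as
        division by 0 yields 0. Otherwise the two sides are equal.\<close>
      by (cases "n * fdim \<rho> = 0")
        (auto simp: power_divide power_mult_distrib field_simps power2_eq_square)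
  qed
  \<comment> \<open>With the weights \<open>c\<close>, the signal equals the same
    \<open>n * S\<close> that bounds the noise in \<open>noise_var\<close>.\<close>
  have signal: "(\<Sum>\<rho>\<in>\<Psi>. c \<rho> * (lam \<rho> / n) * frob (gram n \<rho> g) (gram n \<rho> g)) = n * S"
    if g: "\<And>u. u < n \<Longrightarrow> g u \<in> carrier G" for n g
    unfolding S_def sum_distrib_left
  proof (rule sum.cong[OF refl])
    fix \<rho> assume r: "\<rho> \<in> \<Psi>"
    have fg: "frob (gram n \<rho> g) (gram n \<rho> g) = (real n)\<^sup>2 * fdim \<rho>"
      by (rule frob_gram[OF unitary[OF r]]) (erule g)
    show "c \<rho> * (lam \<rho> / n) * frob (gram n \<rho> g) (gram n \<rho> g) =
        n * ((lam \<rho>)\<^sup>2 * beta (ftype \<rho>) * (real (fdim \<rho>))\<^sup>2)"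
      unfolding fg c_def
      by (cases "n = 0") (auto simp: field_simps power2_eq_square)
  qed

  have typeI: "emeasure (gsynch n (\<lambda>_. 0) G \<Psi>) {Y \<in> space (obs_space n \<Psi>). test n Y} \<le>
      ennreal ((L * exp (- (t\<^sup>2 / (4 * S)))) ^ n)" for n
  proof (rule emeasure_gsynch_le[OF assms(2) ne])
    fix g :: "nat \<Rightarrow> 'a"
    let ?B = "\<lambda>h. {W \<in> space (noise n \<Psi>). n * t \<le> stat (e n) n \<Psi> h W}"
    have B: "?B h \<in> sets (noise n \<Psi>)" for h by measurable
    have "emeasure (noise n \<Psi>) (\<Union>h\<in>H n. ?B h) \<le> (\<Sum>h\<in>H n. emeasure (noise n \<Psi>) (?B h))"
      using B finH by (intro emeasure_subadditive_finite) auto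
    also have "\<dots> \<le> (\<Sum>h\<in>H n. ennreal (exp (- (t\<^sup>2 / (4 * S))) ^ n))"
      by (intro sum_mono stat_tail fin S t0 noise_var) (auto simp: H_def)
    also have "\<dots> = ennreal ((L * exp (- (t\<^sup>2 / (4 * S)))) ^ n)"
      by (simp add: cardH power_mult_distrib ennreal_mult ennreal_power ennreal_of_nat_eq_real_of_nat)
    finally have "emeasure (noise n \<Psi>) (\<Union>h\<in>H n. ?B h) \<le> \<dots>" .
    \<comment> \<open>Without a spike the observed statistic is the noise statistic with weights
      \<open>e n\<close>, so the rejection event lies in a union of tail events that does not depend
      on \<open>g\<close>.\<close>
    moreover have "{W \<in> space (noise n \<Psi>). (\<lambda>\<rho>\<in>\<Psi>. spiked n 0 \<rho> g (W \<rho>)) \<in>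
        {Y \<in> space (obs_space n \<Psi>). test n Y}} \<subseteq> (\<Union>h\<in>H n. ?B h)"
      using stat_spiked[of _ n \<Psi> c _ "\<lambda>_. 0" g] by (auto simp: test_def e_def)
    ultimately show "\<exists>B\<in>sets (noise n \<Psi>).
        emeasure (noise n \<Psi>) B \<le> ennreal ((L * exp (- (t\<^sup>2 / (4 * S)))) ^ n) \<and>
        {W \<in> space (noise n \<Psi>). (\<lambda>\<rho>\<in>\<Psi>. spiked n 0 \<rho> g (W \<rho>)) \<in>
          {Y \<in> space (obs_space n \<Psi>). test n Y}} \<subseteq> B"
      using B finH by (intro bexI[of _ "\<Union>h\<in>H n. ?B h"] conjI sets.finite_UN) auto
  qed measurable

  have typeII: "emeasure (gsynch n lam G \<Psi>) {Y \<in> space (obs_space n \<Psi>). \<not> test n Y} \<le>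
      ennreal (exp (- ((S - t)\<^sup>2 / (4 * S))) ^ n)" for n
  proof (rule emeasure_gsynch_le[OF assms(2) ne])
    fix g :: "nat \<Rightarrow> 'a" assume g: "\<And>u. u < n \<Longrightarrow> g u \<in> carrier G"
    \<comment> \<open>Values of \<open>g\<close> beyond \<open>n\<close> are arbitrary; restricting
      makes the truth a member of \<open>H n\<close> without changing its Gram matrices.\<close>
    define h where "h = restrict g {..<n}"
    have hG: "\<And>u. u < n \<Longrightarrow> h u \<in> carrier G" and h: "h \<in> H n"
      using g by (auto simp: h_def H_def)
    have gram_eq: "gram n \<rho> g = gram n \<rho> h" for \<rho>
    proof -
      have "stacked n \<rho> g = stacked n \<rho> h"
        by (rule eq_matI) (auto simp: stacked_def h_def less_mult_imp_div_less)
      then show ?thesis by (simp add: gram_def)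
    qed
    \<comment> \<open>Acceptance forces the noise at the truth below \<open>- n * (S - t)\<close>.
      Negating the weights makes this an upper tail for \<open>stat_tail\<close>, and
      \<open>noise_var\<close> still applies because the weights enter it squared.\<close>
    let ?B = "{W \<in> space (noise n \<Psi>). n * (S - t) \<le> stat (\<lambda>\<rho>. - e n \<rho>) n \<Psi> h W}"
    have B: "?B \<in> sets (noise n \<Psi>)" by measurable
    have "emeasure (noise n \<Psi>) ?B \<le> ennreal (exp (- ((S - t)\<^sup>2 / (4 * S))) ^ n)"
      using t(2) noise_var[OF hG] by (intro stat_tail fin S) auto
    moreover have "{W \<in> space (noise n \<Psi>). (\<lambda>\<rho>\<in>\<Psi>. spiked n (lam \<rho>) \<rho> g (W \<rho>)) \<in>
        {Y \<in> space (obs_space n \<Psi>). \<not> test n Y}} \<subseteq> ?B"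
    proof clarsimp
      fix W assume W: "W \<in> space (noise n \<Psi>)"
        and "\<not> test n (\<lambda>\<rho>\<in>\<Psi>. spiked n (lam \<rho>) \<rho> g (W \<rho>))"
      then have "stat c n \<Psi> h (\<lambda>\<rho>\<in>\<Psi>. spiked n (lam \<rho>) \<rho> g (W \<rho>)) < n * t"
        using h by (auto simp: test_def not_le)
      moreover have "stat c n \<Psi> h (\<lambda>\<rho>\<in>\<Psi>. spiked n (lam \<rho>) \<rho> g (W \<rho>)) = n * S + stat (e n) n \<Psi> h W"
        using stat_spiked[OF W, of c h lam g] signal[of n h] hG
        by (simp add: gram_eq e_def)
      moreover have "stat (\<lambda>\<rho>. - e n \<rho>) n \<Psi> h W = - stat (e n) n \<Psi> h W"
        by (simp add: stat_def sum_negf)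
      ultimately show "n * (S - t) \<le> stat (\<lambda>\<rho>. - e n \<rho>) n \<Psi> h W"
        by (simp add: algebra_simps)
    qed
    ultimately show "\<exists>B\<in>sets (noise n \<Psi>).
        emeasure (noise n \<Psi>) B \<le> ennreal (exp (- ((S - t)\<^sup>2 / (4 * S))) ^ n) \<and>
        {W \<in> space (noise n \<Psi>). (\<lambda>\<rho>\<in>\<Psi>. spiked n (lam \<rho>) \<rho> g (W \<rho>)) \<in>
          {Y \<in> space (obs_space n \<Psi>). \<not> test n Y}} \<subseteq> B"
      using B by blast
  qed measurable

  have tendsto0: "(\<lambda>n. measure (M n) (A n)) \<longlonglongrightarrow> 0"
    if "\<And>n. emeasure (M n) (A n) \<le> ennreal (r ^ n)" "0 \<le> r" "r < 1"
    for M :: "nat \<Rightarrow> ('a freq \<Rightarrow> quat mat) measure" and A r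
  proof (rule tendsto_sandwich[OF _ _ tendsto_const LIMSEQ_realpow_zero[OF that(2,3)]])
    show "\<forall>\<^sub>F n in sequentially. measure (M n) (A n) \<le> r ^ n"
      using enn2real_mono[OF that(1)] that(2) by (auto simp: measure_def)
  qed simp
  have "L * exp (- (t\<^sup>2 / (4 * S))) = exp (ln (real L) - t\<^sup>2 / (4 * S))"
    unfolding diff_conv_add_uminus exp_add using L by simp
  then have r1: "L * exp (- (t\<^sup>2 / (4 * S))) < 1" using tL by simp
  have r2: "exp (- ((S - t)\<^sup>2 / (4 * S))) < 1" using t(2) S by simp
  show ?thesis
    using meas tendsto0[OF typeI _ r1] tendsto0[OF typeII _ r2] by (intro exI[of _ test]) simp
qed

end
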